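(* Let $l\ge 2$ be an integer and let $\mathcal{H}=(V,H)$ be the $l$-lattice hypergraph. The eigenvalues of its hyperedge-based Laplacian $L_{\mathrm{h}}$ are $$\mu_0=0\ (\text{multiplicity }1),\qquad \mu_1=\frac{l}{l-1}\ (\text{multiplicity }2(l-1)),\qquad \mu_2=\frac{2l}{l-1}\ (\text{multiplicity }(l-1)^2).$$
   Context: The $l$-lattice hypergraph has $l^2$ vertices $(r,c)$, $r,c\in\{0,\dots,l-1\}$, arranged in an $l\times l$ grid, and exactly $2l$ hyperedges: the $l$ rows $\{(r,c):0\le c\le l-1\}$ and the $l$ columns $\{(r,c):0\le r\le l-1\}$. Hyperedge-based Laplacian: $L_{\mathrm{h}}=D_{\mathrm{h}}-A_{\mathrm{h}}$, where $A_{\mathrm{h}}(u,u)=0$, $A_{\mathrm{h}}(u,v)=\sum_{e\ni u,v}\frac{1}{|e|-1}$ for $u\neq v$ (sum over hyperedges $e$ containing both $u$ and $v$), and $D_{\mathrm{h}}$ is the diagonal matrix whose entry at $u$ is the number of hyperedges containing $u$. For the $l$-lattice this is $L_{\mathrm{h}}=2I_{l^2}-\frac{1}{l-1}A_{\mathrm{cl}}$, where $A_{\mathrm{cl}}=(J_l-I_l)\otimes I_l+I_l\otimes(J_l-I_l)$, with $J_l$ the $l\times l$ all-ones matrix and $I_l$ the identity. *)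

theory Defs
  imports "Jordan_Normal_Form.Char_Poly"
begin

text \<open>A hypergraph is given by a vertex set and a set of hyperedges (vertex sets). Its matrices are
  written with respect to a list \<open>vs\<close> enumerating the vertices: row and column \<open>i\<close> belong to
  the vertex \<open>vs ! i\<close>.\<close>

definition hyperedge_degree :: "'v set set \<Rightarrow> 'v \<Rightarrow> nat" where
  "hyperedge_degree H u = card {e \<in> H. u \<in> e}"

definition hyperedge_adjacency :: "'v set set \<Rightarrow> 'v \<Rightarrow> 'v \<Rightarrow> real" where
  "hyperedge_adjacency H u v =
     (if u = v then 0 else (\<Sum>e\<in>{e \<in> H. u \<in> e \<and> v \<in> e}. 1 / (real (card e) - 1)))"

definition hyperedge_degree_mat :: "'v set set \<Rightarrow> 'v list \<Rightarrow> real mat" where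
  "hyperedge_degree_mat H vs = mat_diag (length vs) (\<lambda>i. real (hyperedge_degree H (vs ! i)))"

definition hyperedge_adjacency_mat :: "'v set set \<Rightarrow> 'v list \<Rightarrow> real mat" where
  "hyperedge_adjacency_mat H vs =
     mat (length vs) (length vs) (\<lambda>(i, j). hyperedge_adjacency H (vs ! i) (vs ! j))"

definition hyperedge_laplacian :: "'v set set \<Rightarrow> 'v list \<Rightarrow> real mat" where
  "hyperedge_laplacian H vs = hyperedge_degree_mat H vs - hyperedge_adjacency_mat H vs"

definition lattice_vertices :: "nat \<Rightarrow> (nat \<times> nat) set" where
  "lattice_vertices l = {0..<l} \<times> {0..<l}"

definition lattice_row :: "nat \<Rightarrow> nat \<Rightarrow> (nat \<times> nat) set" where
  "lattice_row l r = {(r, c) |c. c < l}"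

definition lattice_column :: "nat \<Rightarrow> nat \<Rightarrow> (nat \<times> nat) set" where
  "lattice_column l c = {(r, c) |r. r < l}"

definition lattice_hyperedges :: "nat \<Rightarrow> (nat \<times> nat) set set" where
  "lattice_hyperedges l = lattice_row l ` {0..<l} \<union> lattice_column l ` {0..<l}"

text \<open>For \<open>l \<ge> 2\<close> the rows and columns are pairwise distinct as sets, so that a set of
  hyperedges loses nothing.\<close>

lemma card_lattice_hyperedges:
  assumes "l \<ge> 2"
  shows "card (lattice_hyperedges l) = 2 * l"
proof -
  have row: "(a, b) \<in> lattice_row l r \<longleftrightarrow> a = r \<and> b < l" for a b r
    by (auto simp: lattice_row_def)
  have col: "(a, b) \<in> lattice_column l c \<longleftrightarrow> b = c \<and> a < l" for a b c
    by (auto simp: lattice_column_def)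
  have "inj_on (lattice_row l) {0..<l}"
  proof (rule inj_onI)
    fix r r' assume "lattice_row l r = lattice_row l r'"
    then show "r = r'" using row[of r 0 r] row[of r 0 r'] assms by auto
  qed
  moreover have "inj_on (lattice_column l) {0..<l}"
  proof (rule inj_onI)
    fix c c' assume "lattice_column l c = lattice_column l c'"
    then show "c = c'" using col[of 0 c c] col[of 0 c c'] assms by auto
  qed
  moreover have "lattice_row l r \<noteq> lattice_column l c" for r c
  proof
    assume "lattice_row l r = lattice_column l c"
    then show False
      using row[of r 0 r] row[of r 1 r] col[of r 0 c] col[of r 1 c] assms by auto
  qed
  then have "lattice_row l ` {0..<l} \<inter> lattice_column l ` {0..<l} = {}"
    by blast
  ultimately show ?thesis
    unfolding lattice_hyperedges_def by (simp add: card_Un_disjoint card_image)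
qed

end

theory Submission
  imports Defs
begin

text \<open>In the basis \<open>f\<^sub>0 = (1, \<dots>, 1)\<close>, \<open>f\<^sub>k = e\<^sub>0 - e\<^sub>k\<close> (\<open>k \<ge> 1\<close>) of eigenvectors of
  \<open>J - I\<close>, with eigenvalues \<open>l - 1\<close> and \<open>-1\<close>, the inverse of the change of basis is explicit.
  The products \<open>f\<^sub>j \<otimes> f\<^sub>k\<close> then diagonalise \<open>(J - I) \<otimes> I + I \<otimes> (J - I)\<close>, hence the Laplacian,
  and the multiplicities are obtained by counting the pairs \<open>(j, k)\<close> according to which
  components vanish.\<close>

section \<open>Matrices as kernels on an enumerated vertex set\<close>

definition kernel_mat :: "'v list \<Rightarrow> ('v \<Rightarrow> 'v \<Rightarrow> 'a) \<Rightarrow> 'a mat" where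
  "kernel_mat vs K = mat (length vs) (length vs) (\<lambda>(i, j). K (vs ! i) (vs ! j))"

lemma kernel_mat_carrier [simp]: "kernel_mat vs K \<in> carrier_mat (length vs) (length vs)"
  by (simp add: kernel_mat_def)

lemma kernel_mat_cong:
  assumes "\<And>u v. u \<in> set vs \<Longrightarrow> v \<in> set vs \<Longrightarrow> K u v = K' u v"
  shows "kernel_mat vs K = kernel_mat vs K'"
  using assms by (intro eq_matI) (auto simp: kernel_mat_def)

text \<open>Distinctness makes indexing a bijection onto the vertex set, so the sum over indices
  becomes a sum over vertices and the enumeration drops out of all later calculations.\<close>

lemma kernel_mat_mult:
  fixes K K' :: "'v \<Rightarrow> 'v \<Rightarrow> 'a :: semiring_0"
  assumes "distinct vs"
  shows "kernel_mat vs K * kernel_mat vs K' = kernel_mat vs (\<lambda>u w. \<Sum>v\<in>set vs. K u v * K' v w)"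
proof -
  have "(\<Sum>i = 0..<length vs. f (vs ! i)) = (\<Sum>v\<in>set vs. f v)" for f :: "'v \<Rightarrow> 'a"
    using bij_betw_nth[OF assms, of "{0..<length vs}" "set vs"]
    by (intro sum.reindex_bij_betw) (auto simp: atLeast0LessThan)
  then show ?thesis
    by (intro eq_matI) (auto simp: kernel_mat_def scalar_prod_def)
qed

lemma kernel_mat_one:
  assumes "distinct vs"
  shows "kernel_mat vs (\<lambda>u v. of_bool (u = v)) = (1\<^sub>m (length vs) :: 'a :: semiring_1 mat)"
  using assms by (intro eq_matI) (auto simp: kernel_mat_def nth_eq_iff_index_eq)

section \<open>Multiplicities from an explicit diagonalisation\<close>

lemma order_prod_list_linear:
  fixes xs :: "'a :: idom list"
  shows "order a (\<Prod>x\<leftarrow>xs. [:- x, 1:]) = length (filter (\<lambda>x. x = a) xs)"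
proof (induction xs)
  case (Cons x xs)
  have "(\<Prod>x\<leftarrow>xs. [:- x, 1:]) \<noteq> 0"
    by (auto simp: prod_list_zero_iff)
  then have "order a (\<Prod>x\<leftarrow>x # xs. [:- x, 1:]) = order a [:- x, 1:] + order a (\<Prod>x\<leftarrow>xs. [:- x, 1:])"
    by (simp add: order_mult del: mult_pCons_left)
  moreover have "order a [:- x, 1:] = (if x = a then 1 else 0)"
    using order_power_n_n[of a 1] by (auto simp: order_0I)
  ultimately show ?case
    using Cons.IH by simp
qed simp

text \<open>Column \<open>w\<close> of \<open>P\<close> is an eigenvector for \<open>d w\<close>,
  and \<open>R\<close> inverts \<open>P\<close>. So the matrix is similar to the diagonal matrix of
  \<open>d\<close>, and each vertex contributes one linear factor.\<close>

lemma order_char_poly_kernel_mat: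
  fixes K P R :: "'v \<Rightarrow> 'v \<Rightarrow> 'a :: field"
  assumes dist: "distinct vs"
    and PR: "\<And>u w. u \<in> set vs \<Longrightarrow> w \<in> set vs \<Longrightarrow> (\<Sum>v\<in>set vs. P u v * R v w) = of_bool (u = w)"
    and KP: "\<And>u w. u \<in> set vs \<Longrightarrow> w \<in> set vs \<Longrightarrow> (\<Sum>v\<in>set vs. K u v * P v w) = P u w * d w"
  shows "order a (char_poly (kernel_mat vs K)) = card {v \<in> set vs. d v = a}"
proof -
  let ?n = "length vs"
  let ?D = "kernel_mat vs (\<lambda>u v. of_bool (u = v) * d v)"
  have PR1: "kernel_mat vs P * kernel_mat vs R = 1\<^sub>m ?n"
    unfolding kernel_mat_mult[OF dist] kernel_mat_one[OF dist, symmetric]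
    by (intro kernel_mat_cong) (simp add: PR)
  \<comment> \<open>For square matrices over a field a right inverse is also a left inverse.\<close>
  then have RP1: "kernel_mat vs R * kernel_mat vs P = 1\<^sub>m ?n"
    by (rule mat_mult_left_right_inverse[OF kernel_mat_carrier kernel_mat_carrier])
  have "kernel_mat vs K * kernel_mat vs P = kernel_mat vs P * ?D"
    unfolding kernel_mat_mult[OF dist]
  proof (rule kernel_mat_cong)
    fix u w assume "u \<in> set vs" "w \<in> set vs"
    then show "(\<Sum>v\<in>set vs. K u v * P v w) = (\<Sum>v\<in>set vs. P u v * (of_bool (v = w) * d w))"
      by (simp add: KP of_bool_def if_distrib if_distribR cong: if_cong)
  qed
  then have "kernel_mat vs P * ?D * kernel_mat vs R
      = kernel_mat vs K * (kernel_mat vs P * kernel_mat vs R)"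
    using assoc_mult_mat[OF kernel_mat_carrier kernel_mat_carrier kernel_mat_carrier, of vs K P R]
    by simp
  then have KPDR: "kernel_mat vs K = kernel_mat vs P * ?D * kernel_mat vs R"
    unfolding PR1 right_mult_one_mat[OF kernel_mat_carrier] by (rule sym)
  have "similar_mat (kernel_mat vs K) ?D"
    by (rule similar_matI[OF _ PR1 RP1 KPDR]) simp
  then have "char_poly (kernel_mat vs K) = char_poly ?D"
    by (rule char_poly_similar)
  also have "\<dots> = (\<Prod>x\<leftarrow>diag_mat ?D. [:- x, 1:])"
    using dist
    by (intro char_poly_upper_triangular[of _ ?n]) (auto simp: kernel_mat_def nth_eq_iff_index_eq)
  also have "diag_mat ?D = map d vs"
    by (intro nth_equalityI) (auto simp: diag_mat_def kernel_mat_def)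
  finally have "order a (char_poly (kernel_mat vs K)) = length (filter (\<lambda>v. d v = a) vs)"
    by (simp only: order_prod_list_linear filter_map length_map o_def)
  then show ?thesis
    using dist by (simp add: distinct_card[symmetric])
qed

section \<open>Incidences and the Laplacian of the lattice\<close>

lemma lattice_hyperedges_containing:
  assumes "r < l" "c < l"
  shows "{e \<in> lattice_hyperedges l. (r, c) \<in> e} = {lattice_row l r, lattice_column l c}"
  using assms by (auto simp: lattice_hyperedges_def lattice_row_def lattice_column_def)

text \<open>A row has two vertices with different second coordinates, a column does not. Hence the
  row and the column through a vertex count as two hyperedges.\<close>

lemma lattice_row_neq_column:
  assumes "l \<ge> 2"
  shows "lattice_row l r \<noteq> lattice_column l c"
proof
  assume eq: "lattice_row l r = lattice_column l c"
  have "(r, 0) \<in> lattice_row l r" "(r, 1) \<in> lattice_row l r"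
    using assms by (auto simp: lattice_row_def)
  then show False
    unfolding eq by (auto simp: lattice_column_def)
qed

lemma card_lattice_row: "card (lattice_row l r) = l"
proof -
  have "lattice_row l r = Pair r ` {0..<l}"
    by (auto simp: lattice_row_def)
  then show ?thesis
    by (simp add: card_image inj_on_def)
qed

lemma card_lattice_column: "card (lattice_column l c) = l"
proof -
  have "lattice_column l c = (\<lambda>r. (r, c)) ` {0..<l}"
    by (auto simp: lattice_column_def)
  then show ?thesis
    by (simp add: card_image inj_on_def)
qed

lemma lattice_degree:
  assumes "l \<ge> 2" "r < l" "c < l"
  shows "hyperedge_degree (lattice_hyperedges l) (r, c) = 2"
  using assms by (simp add: hyperedge_degree_def lattice_hyperedges_containing lattice_row_neq_column)

text \<open>Distinct vertices share at most one hyperedge, a row or a column of size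
  \<open>l\<close>, which has weight 1/(l-1).\<close>

lemma lattice_adjacency:
  assumes "l \<ge> 2" "r < l" "c < l" "r' < l" "c' < l"
  shows "hyperedge_adjacency (lattice_hyperedges l) (r, c) (r', c') =
    (of_bool (r \<noteq> r') * of_bool (c = c') + of_bool (r = r') * of_bool (c \<noteq> c')) / (real l - 1)"
proof (cases "(r, c) = (r', c')")
  case False
  have "{e \<in> lattice_hyperedges l. (r, c) \<in> e \<and> (r', c') \<in> e}
      = {e \<in> {lattice_row l r, lattice_column l c}. (r', c') \<in> e}"
    using lattice_hyperedges_containing[OF assms(2,3)] by auto
  also have "\<dots> = (if r = r' then {lattice_row l r} else {}) \<union> (if c = c' then {lattice_column l c} else {})"
    using assms by (auto simp: lattice_row_def lattice_column_def)
  finally show ?thesis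
    using False by (auto simp: hyperedge_adjacency_def card_lattice_row card_lattice_column)
qed (simp add: hyperedge_adjacency_def)

text \<open>Each term is a product of one factor per coordinate, the entrywise form of a Kronecker
  product, so that sums over the grid factorise.\<close>

definition lattice_kernel :: "nat \<Rightarrow> nat \<times> nat \<Rightarrow> nat \<times> nat \<Rightarrow> real" where
  "lattice_kernel l u v = 2 * (of_bool (fst u = fst v) * of_bool (snd u = snd v))
     - (of_bool (fst u \<noteq> fst v) * of_bool (snd u = snd v)
        + of_bool (fst u = fst v) * of_bool (snd u \<noteq> snd v)) / (real l - 1)"

lemma lattice_laplacian_eq_kernel_mat:
  assumes "l \<ge> 2" "distinct vs" "set vs = lattice_vertices l"
  shows "hyperedge_laplacian (lattice_hyperedges l) vs = kernel_mat vs (lattice_kernel l)"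
proof (rule eq_matI)
  fix i j
  assume "i < dim_row (kernel_mat vs (lattice_kernel l))" "j < dim_col (kernel_mat vs (lattice_kernel l))"
  then have i: "i < length vs" and j: "j < length vs"
    by (simp_all add: kernel_mat_def)
  obtain r c r' c' where eq: "vs ! i = (r, c)" "vs ! j = (r', c')"
    by (metis surj_pair)
  have "vs ! i \<in> lattice_vertices l" "vs ! j \<in> lattice_vertices l"
    using i j assms(3) nth_mem by blast+
  then have lt: "r < l" "c < l" "r' < l" "c' < l"
    by (auto simp: eq lattice_vertices_def)
  have "i = j \<longleftrightarrow> r = r' \<and> c = c'"
    using nth_eq_iff_index_eq[OF assms(2) i j] eq by auto
  then show "hyperedge_laplacian (lattice_hyperedges l) vs $$ (i, j) = kernel_mat vs (lattice_kernel l) $$ (i, j)"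
    using i j lt assms(1)
    by (simp add: hyperedge_laplacian_def hyperedge_degree_mat_def hyperedge_adjacency_mat_def
        kernel_mat_def mat_diag_def eq lattice_degree lattice_adjacency lattice_kernel_def)
qed (simp_all add: hyperedge_laplacian_def hyperedge_adjacency_mat_def kernel_mat_def)

section \<open>The eigenbasis of J - I in one coordinate\<close>

definition contrast :: "nat \<Rightarrow> nat \<Rightarrow> real" where
  "contrast i k = (if k = 0 then 1 else of_bool (i = 0) - of_bool (i = k))"

text \<open>Coordinates of a vector x in the basis given by the columns of \<open>contrast\<close>:
  the coefficient c of the all-ones vector is the mean of x, and entry k >= 1 of x equals c minus
  the k-th coefficient.\<close>

definition contrast_inv :: "nat \<Rightarrow> nat \<Rightarrow> nat \<Rightarrow> real" where
  "contrast_inv l k j = 1 / real l - (if k = 0 then 0 else of_bool (k = j))"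

definition contrast_eigenvalue :: "nat \<Rightarrow> nat \<Rightarrow> real" where
  "contrast_eigenvalue l k = (if k = 0 then real l - 1 else - 1)"

lemma sum_of_bool_mult:
  fixes f :: "nat \<Rightarrow> real"
  assumes "i < l"
  shows "(\<Sum>j<l. of_bool (i = j) * f j) = f i"
  using assms by (simp add: of_bool_def if_distrib if_distribR cong: if_cong)

lemma contrast_mult_inv:
  assumes "i < l" "j < l"
  shows "(\<Sum>k<l. contrast i k * contrast_inv l k j) = of_bool (i = j)"
proof -
  obtain m where l: "l = Suc m"
    using assms(1) by (cases l) auto
  have "(\<Sum>k<l. contrast i k * contrast_inv l k j)
      = 1 / l + (\<Sum>k<m. (of_bool (i = 0) - of_bool (i = Suc k)) * (1 / l - of_bool (Suc k = j)))"
    unfolding l by (subst sum.lessThan_Suc_shift) (simp add: contrast_def contrast_inv_def)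
  also have "\<dots> = of_bool (i = j)"
  proof (cases i)
    case 0
    \<comment> \<open>Row 0 of \<open>contrast\<close> is all ones, so the whole sum contributes;
      the m + 1 = l copies of 1/l add up to 1.\<close>
    have "(\<Sum>k<m. of_bool (Suc k = j) :: real) = of_bool (0 < j)"
      using assms(2) by (cases j) (auto simp: l of_bool_def)
    then have "(\<Sum>k<m. 1 / l - of_bool (Suc k = j)) = m / l - of_bool (0 < j)"
      by (simp only: sum_subtractf) simp
    moreover have "1 / l + m / l = 1"
      by (simp add: l flip: add_divide_distrib)
    ultimately show ?thesis
      by (auto simp: 0)
  next
    case (Suc i')
    \<comment> \<open>Only the term k = i' survives, and its 1/l cancels the one from the all-ones
      vector.\<close>
    have "(\<Sum>k<m. (of_bool (i = 0) - of_bool (i = Suc k)) * (1 / l - of_bool (Suc k = j)))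
      = - (\<Sum>k<m. of_bool (i' = k) * (1 / l - of_bool (Suc k = j)))"
      by (simp add: Suc sum_negf)
    then show ?thesis
      using assms by (subst (asm) sum_of_bool_mult) (auto simp: l Suc)
  qed
  finally show ?thesis .
qed

text \<open>J sends a vector to its entry sum times the all-ones vector. That sum is
  \<open>l\<close> for k = 0 and 0 otherwise; subtracting the identity lowers the eigenvalue by
  1.\<close>

lemma contrast_eigenvector:
  assumes "i < l" "k < l"
  shows "(\<Sum>j<l. of_bool (i \<noteq> j) * contrast j k) = contrast_eigenvalue l k * contrast i k"
proof -
  have "(\<Sum>j<l. of_bool (i \<noteq> j) * contrast j k)
      = (\<Sum>j<l. contrast j k) - (\<Sum>j<l. of_bool (i = j) * contrast j k)"
    unfolding sum_subtractf[symmetric] by (intro sum.cong) auto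
  also have "(\<Sum>j<l. of_bool (i = j) * contrast j k) = contrast i k"
    using assms(1) by (rule sum_of_bool_mult)
  also have "(\<Sum>j<l. contrast j k) = (if k = 0 then real l else 0)"
  proof -
    have "(\<Sum>j<l. of_bool (j = n) :: real) = 1" if "n < l" for n
      using that by (simp add: of_bool_def)
    from this[OF assms(2)] this[OF le_less_trans[OF le0 assms(2)]]
    have "(\<Sum>j<l. of_bool (j = 0) - of_bool (j = k) :: real) = 0"
      by (simp only: sum_subtractf)
    then show ?thesis
      by (simp add: contrast_def)
  qed
  also have "\<dots> - contrast i k = contrast_eigenvalue l k * contrast i k"
    by (simp add: contrast_eigenvalue_def contrast_def)
  finally show ?thesis .
qed

section \<open>Tensor products of the eigenvectors on the grid\<close>

lemma sum_lattice_vertices_product: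
  "(\<Sum>v\<in>lattice_vertices l. f (fst v) * g (snd v)) = (\<Sum>i<l. f i) * (\<Sum>j<l. g j :: real)"
  by (simp add: lattice_vertices_def sum_product sum.cartesian_product case_prod_beta atLeast0LessThan)

text \<open>Here \<open>v\<close> is a pair of basis indices, not a position: the tensor products of
  basis vectors are indexed by the vertex set itself, which keeps the change of basis
  square.\<close>

definition lattice_eigenvalue :: "nat \<Rightarrow> nat \<times> nat \<Rightarrow> real" where
  "lattice_eigenvalue l v =
     2 - (contrast_eigenvalue l (fst v) + contrast_eigenvalue l (snd v)) / (real l - 1)"

lemma order_char_poly_lattice:
  assumes "distinct vs" "set vs = lattice_vertices l"
  shows "order a (char_poly (kernel_mat vs (lattice_kernel l)))
    = card {v \<in> lattice_vertices l. lattice_eigenvalue l v = a}"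
proof -
  \<comment> \<open>\<open>P\<close> and \<open>R\<close> are the Kronecker squares of
    \<open>contrast\<close> and \<open>contrast_inv\<close>, hence inverse to each other by
    factorisation.\<close>
  define P where "P u v = contrast (fst u) (fst v) * contrast (snd u) (snd v)" for u v
  define R where "R u v = contrast_inv l (fst u) (fst v) * contrast_inv l (snd u) (snd v)" for u v
  have PR: "(\<Sum>v\<in>lattice_vertices l. P u v * R v w) = of_bool (u = w)"
    if "u \<in> lattice_vertices l" "w \<in> lattice_vertices l" for u w
  proof -
    have "(\<Sum>v\<in>lattice_vertices l. P u v * R v w)
      = (\<Sum>v\<in>lattice_vertices l. (contrast (fst u) (fst v) * contrast_inv l (fst v) (fst w))
          * (contrast (snd u) (snd v) * contrast_inv l (snd v) (snd w)))"
      by (simp add: P_def R_def mult_ac)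
    also have "\<dots> = of_bool (fst u = fst w) * of_bool (snd u = snd w)"
      using that by (subst sum_lattice_vertices_product)
        (auto simp: contrast_mult_inv lattice_vertices_def)
    finally show ?thesis
      by (auto simp: prod_eq_iff)
  qed
  have KP: "(\<Sum>v\<in>lattice_vertices l. lattice_kernel l u v * P v w) = P u w * lattice_eigenvalue l w"
    if "u \<in> lattice_vertices l" "w \<in> lattice_vertices l" for u w
  proof -
    \<comment> \<open>Summands of I and of J - I applied to a basis vector: \<open>?d\<close> sums
      to the entry itself, \<open>?a\<close> to the eigenvalue times the entry.\<close>
    let ?d = "\<lambda>i k j. of_bool (i = j) * contrast j k"
    let ?a = "\<lambda>i k j. of_bool (i \<noteq> j) * contrast j k"
    have lt: "fst u < l" "snd u < l" "fst w < l" "snd w < l"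
      using that by (auto simp: lattice_vertices_def)
    have "(\<Sum>v\<in>lattice_vertices l. lattice_kernel l u v * P v w)
      = (\<Sum>v\<in>lattice_vertices l.
          2 * (?d (fst u) (fst w) (fst v) * ?d (snd u) (snd w) (snd v))
          - (?a (fst u) (fst w) (fst v) * ?d (snd u) (snd w) (snd v)
             + ?d (fst u) (fst w) (fst v) * ?a (snd u) (snd w) (snd v)) / (real l - 1))"
      by (intro sum.cong refl) (simp add: lattice_kernel_def P_def algebra_simps add_divide_distrib)
    also have "\<dots> = 2 * P u w - (contrast_eigenvalue l (fst w) * P u w
        + contrast_eigenvalue l (snd w) * P u w) / (real l - 1)"
      unfolding sum_subtractf sum_distrib_left[symmetric] sum_divide_distrib[symmetric]
        sum.distrib
        sum_lattice_vertices_product[of "?d (fst u) (fst w)" "?d (snd u) (snd w)"]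
        sum_lattice_vertices_product[of "?a (fst u) (fst w)" "?d (snd u) (snd w)"]
        sum_lattice_vertices_product[of "?d (fst u) (fst w)" "?a (snd u) (snd w)"]
        sum_of_bool_mult[OF lt(1)] sum_of_bool_mult[OF lt(2)]
        contrast_eigenvector[OF lt(1,3)] contrast_eigenvector[OF lt(2,4)]
      by (simp add: P_def mult_ac)
    also have "\<dots> = P u w * lattice_eigenvalue l w"
      by (simp add: lattice_eigenvalue_def algebra_simps add_divide_distrib)
    finally show ?thesis .
  qed
  show ?thesis
    using order_char_poly_kernel_mat[of vs P R "lattice_kernel l" "lattice_eigenvalue l" a]
      PR KP assms by simp
qed

section \<open>Counting index pairs by eigenvalue\<close>

lemma lattice_eigenvalue_cases:
  assumes "l \<ge> 2"
  shows "lattice_eigenvalue l (j, k) =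
    (if j = 0 \<and> k = 0 then 0 else if j = 0 \<or> k = 0 then real l / (real l - 1)
     else 2 * real l / (real l - 1))"
  using assms by (auto simp: lattice_eigenvalue_def contrast_eigenvalue_def field_simps)

theorem proposition3:
  fixes l :: nat and vs :: "(nat \<times> nat) list" and L :: "real mat"
  assumes "l \<ge> 2"
    and "distinct vs" and "set vs = lattice_vertices l"
    and "L = hyperedge_laplacian (lattice_hyperedges l) vs"
  shows "{\<mu>. eigenvalue L \<mu>} = {0, real l / (real l - 1), 2 * real l / (real l - 1)} \<and>
         Polynomial.order 0 (char_poly L) = 1 \<and>
         Polynomial.order (real l / (real l - 1)) (char_poly L) = 2 * (l - 1) \<and>
         Polynomial.order (2 * real l / (real l - 1)) (char_poly L) = (l - 1)^2"
proof -
  define m1 m2 where "m1 = real l / (real l - 1)" and "m2 = 2 * real l / (real l - 1)"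
  have L: "L = kernel_mat vs (lattice_kernel l)"
    using assms lattice_laplacian_eq_kernel_mat by simp
  have ord: "order a (char_poly L) = card {v \<in> lattice_vertices l. lattice_eigenvalue l v = a}" for a
    unfolding L using assms order_char_poly_lattice by simp
  \<comment> \<open>The three values must differ, so that each multiplicity counts exactly one class
    of index pairs.\<close>
  have ne: "m1 \<noteq> 0" "m2 \<noteq> 0" "m1 \<noteq> m2"
    using assms(1) by (auto simp: m1_def m2_def field_simps)
  note ev = lattice_eigenvalue_cases[OF assms(1), folded m1_def m2_def]
  have "{v \<in> lattice_vertices l. lattice_eigenvalue l v = 0} = {(0, 0)}"
    using assms(1) ne by (auto simp: lattice_vertices_def ev split: if_splits)
  then have o0: "order 0 (char_poly L) = 1"
    by (simp add: ord)
  have "{v \<in> lattice_vertices l. lattice_eigenvalue l v = m1} = {0} \<times> {1..<l} \<union> {1..<l} \<times> {0}"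
    using assms(1) ne ne[symmetric]
    by (auto simp: lattice_vertices_def ev split: if_splits)
  moreover have "card ({0} \<times> {1..<l} \<union> {1..<l} \<times> {0::nat}) = 2 * (l - 1)"
    by (subst card_Un_disjoint) auto
  ultimately have o1: "order m1 (char_poly L) = 2 * (l - 1)"
    by (simp add: ord)
  have "{v \<in> lattice_vertices l. lattice_eigenvalue l v = m2} = {1..<l} \<times> {1..<l}"
    using assms(1) ne ne[symmetric]
    by (auto simp: lattice_vertices_def ev split: if_splits)
  then have o2: "order m2 (char_poly L) = (l - 1)^2"
    by (simp add: ord power2_eq_square)
  have carrier: "L \<in> carrier_mat (length vs) (length vs)"
    by (simp add: L)
  \<comment> \<open>Being monic, the characteristic polynomial is nonzero, so its roots are exactly
    the points of positive order.\<close>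
  have "char_poly L \<noteq> 0"
    using degree_monic_char_poly[OF carrier] by auto
  then have eig: "eigenvalue L a \<longleftrightarrow> order a (char_poly L) \<noteq> 0" for a
    using eigenvalue_root_char_poly[OF carrier] order_root by metis
  \<comment> \<open>Positive order at \<open>a\<close> means that some index pair has eigenvalue
    \<open>a\<close>, and the case distinction leaves only three values.\<close>
  have "a \<in> {0, m1, m2}" if "eigenvalue L a" for a
  proof -
    have "{v \<in> lattice_vertices l. lattice_eigenvalue l v = a} \<noteq> {}"
      using that unfolding eig ord by (metis card.empty)
    then show ?thesis
      by (auto simp: ev split: if_splits)
  qed
  \<comment> \<open>All three values occur because the multiplicities are positive for l \<ge>
    2.\<close>
  moreover have "eigenvalue L 0" "eigenvalue L m1" "eigenvalue L m2"
    using assms(1) by (simp_all only: eig o0 o1 o2) auto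
  ultimately show ?thesis
    using o0 o1 o2 unfolding m1_def m2_def by blast
qed

end
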